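(* Let $d\ge4$ be an integer, $\mu>0$, $a\in\mathbb{R}$, and let $g_{MP1}$ be the $(d+1)$-dimensional Myers-Perry metric with rotation in one plane, considered at points where $r\neq0$ (and $r>0$ if $d\ge5$), $\sin\vartheta\ne0$, $\cos\vartheta\neq0$ and $\Delta_{MP1}(r)\neq0$. Then: (1) If $d=4$, $\partial_r$ is spacelike where $r^2>\mu-a^2$ and timelike where $r^2<\mu-a^2$. If $d\ge5$, with $k=d-4$, $\partial_r$ is spacelike where $r^{2+k}+a^2r^k>\mu$ and timelike where $r^{2+k}+a^2r^k<\mu$. (2) $\partial_\varphi$ is spacelike everywhere. (3) If $d=4$, $\partial_t$ is timelike where $r^2>\mu-a^2\cos^2\vartheta$ and spacelike where $r^2<\mu-a^2\cos^2\vartheta$; in particular it is timelike where $r^2>\mu$ and spacelike where $r^2<\mu-a^2$. If $d\ge5$, with $k=d-4$, $\partial_t$ is spacelike where $\mu>r^k(r^2+a^2\cos^2\vartheta)$ and timelike where $\mu<r^k(r^2+a^2\cos^2\vartheta)$; in particular it is spacelike where $r^{2+k}+a^2r^k<\mu$ and timelike where $r^{2+k}>\mu$. (4) The remaining coordinate vector fields, namely $\partial_\vartheta$ and the coordinate vector fields of the sphere $S^{d-3}$, are spacelike everywhere.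
   Context: In coordinates $t,r,\vartheta,\varphi$ together with (non-degenerate) spherical coordinates on the unit sphere $S^{d-3}$ with round metric $g_{S^{d-3}}$, the Myers-Perry metric with rotation in one plane is $$g_{MP1}=-dt^2+\frac{\mu}{r^{d-4}\rho^2}\left(dt-a\sin^2\vartheta\,d\varphi\right)^2+\frac{\rho^2}{\Delta_{MP1}}dr^2+\rho^2d\vartheta^2+(r^2+a^2)\sin^2\vartheta\,d\varphi^2+r^2\cos^2\vartheta\,g_{S^{d-3}},$$ with $\rho^2=r^2+a^2\cos^2\vartheta$ and $\Delta_{MP1}=r^2+a^2-\frac{\mu}{r^{d-4}}$. The coordinate $r$ ranges over $\mathbb{R}$ when $d=4$ and over $(0,\infty)$ when $d\ge5$. A vector $v$ is spacelike if $g_{MP1}(v,v)>0$ and timelike if $g_{MP1}(v,v)<0$. *)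

theory Defs
  imports "HOL-Analysis.Analysis"
begin

text \<open>
  For a given \<open>d\<close> the spacetime has the \<open>d + 1\<close> coordinates
  \<open>T\<close>, \<open>R\<close>, \<open>Theta\<close>, \<open>Phi\<close> and \<open>Sph i\<close> with \<open>i < d - 3\<close>, the latter being
  the angles on the sphere \<open>S\<^sup>d\<^sup>-\<^sup>3\<close>.  Points and tangent vectors are given by
  their coordinates resp. components; the values at \<open>Sph i\<close> with \<open>i \<ge> d - 3\<close>
  play no role.
\<close>

datatype coord = T | R | Theta | Phi | Sph nat

type_synonym point = "coord \<Rightarrow> real"
type_synonym tangent = "coord \<Rightarrow> real"

definition coord_vec :: "coord \<Rightarrow> tangent" where
  "coord_vec c = (\<lambda>c'. if c' = c then 1 else 0)"

text \<open>
  Spherical coordinates on the unit sphere \<open>S\<^sup>n\<close> in Euclidean \<open>(n + 1)\<close>-space: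
  \<open>x\<^sub>k = cos \<psi>\<^sub>k * (\<Prod>j<k. sin \<psi>\<^sub>j)\<close> for \<open>k < n\<close> and \<open>x\<^sub>n = (\<Prod>j<n. sin \<psi>\<^sub>j)\<close>.
\<close>

definition sphere_param :: "nat \<Rightarrow> (nat \<Rightarrow> real) \<Rightarrow> nat \<Rightarrow> real" where
  "sphere_param n \<psi> k = (if k < n then cos (\<psi> k) else 1) * (\<Prod>j<k. sin (\<psi> j))"

text \<open>
  The chart degenerates exactly where one of the angles other than the last has
  vanishing sine; the usual ranges \<open>\<psi>\<^sub>i \<in> (0, \<pi>)\<close> for \<open>i < n - 1\<close> and
  \<open>\<psi>\<^sub>n\<^sub>-\<^sub>1 \<in> (0, 2\<pi>)\<close> are included.
\<close>

definition sphere_nondegenerate :: "nat \<Rightarrow> (nat \<Rightarrow> real) \<Rightarrow> bool" where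
  "sphere_nondegenerate n \<psi> \<longleftrightarrow> (\<forall>i. Suc i < n \<longrightarrow> sin (\<psi> i) \<noteq> 0)"

definition sphere_diff :: "nat \<Rightarrow> (nat \<Rightarrow> real) \<Rightarrow> (nat \<Rightarrow> real) \<Rightarrow> nat \<Rightarrow> real" where
  "sphere_diff n \<psi> u k = deriv (\<lambda>s. sphere_param n (\<lambda>i. \<psi> i + s * u i) k) 0"

text \<open>The round metric is the pullback of the Euclidean metric under \<open>sphere_param\<close>.\<close>

definition round_metric :: "nat \<Rightarrow> (nat \<Rightarrow> real) \<Rightarrow> (nat \<Rightarrow> real) \<Rightarrow> (nat \<Rightarrow> real) \<Rightarrow> real" where
  "round_metric n \<psi> u v = (\<Sum>k\<le>n. sphere_diff n \<psi> u k * sphere_diff n \<psi> v k)"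

definition rho2 :: "real \<Rightarrow> point \<Rightarrow> real" where
  "rho2 a x = (x R)\<^sup>2 + a\<^sup>2 * (cos (x Theta))\<^sup>2"

definition Delta_MP1 :: "nat \<Rightarrow> real \<Rightarrow> real \<Rightarrow> real \<Rightarrow> real" where
  "Delta_MP1 d \<mu> a r = r\<^sup>2 + a\<^sup>2 - \<mu> / r ^ (d - 4)"

text \<open>
  The metric as a bilinear form in tangent vectors \<open>v\<close>, \<open>w\<close> at the point \<open>x\<close>;
  the component \<open>v T\<close> is \<open>dt(v)\<close>, and similarly for the other coordinates.
\<close>

definition g_MP1 :: "nat \<Rightarrow> real \<Rightarrow> real \<Rightarrow> point \<Rightarrow> tangent \<Rightarrow> tangent \<Rightarrow> real" where
  "g_MP1 d \<mu> a x v w =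
     - v T * w T
     + \<mu> / (x R ^ (d - 4) * rho2 a x)
         * (v T - a * (sin (x Theta))\<^sup>2 * v Phi) * (w T - a * (sin (x Theta))\<^sup>2 * w Phi)
     + rho2 a x / Delta_MP1 d \<mu> a (x R) * v R * w R
     + rho2 a x * v Theta * w Theta
     + ((x R)\<^sup>2 + a\<^sup>2) * (sin (x Theta))\<^sup>2 * v Phi * w Phi
     + (x R)\<^sup>2 * (cos (x Theta))\<^sup>2
         * round_metric (d - 3) (\<lambda>i. x (Sph i)) (\<lambda>i. v (Sph i)) (\<lambda>i. w (Sph i))"

definition MP1_region :: "nat \<Rightarrow> real \<Rightarrow> real \<Rightarrow> point set" where
  "MP1_region d \<mu> a =
     {x. x R \<noteq> 0 \<and> (d \<ge> 5 \<longrightarrow> x R > 0) \<and>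
         sin (x Theta) \<noteq> 0 \<and> cos (x Theta) \<noteq> 0 \<and>
         Delta_MP1 d \<mu> a (x R) \<noteq> 0 \<and>
         sphere_nondegenerate (d - 3) (\<lambda>i. x (Sph i))}"

definition spacelike :: "(tangent \<Rightarrow> tangent \<Rightarrow> real) \<Rightarrow> tangent \<Rightarrow> bool" where
  "spacelike g v \<longleftrightarrow> g v v > 0"

definition timelike :: "(tangent \<Rightarrow> tangent \<Rightarrow> real) \<Rightarrow> tangent \<Rightarrow> bool" where
  "timelike g v \<longleftrightarrow> g v v < 0"

end

theory Submission
  imports Defs
begin

text \<open>Each claim is about the sign of one diagonal component of the metric. Write
  \<open>\<rho>\<close> for \<open>rho2\<close>, so \<open>\<rho> > 0\<close> because r is nonzero.
  The component for \<open>R\<close> is \<open>\<rho>\<close> over \<open>Delta_MP1\<close>, and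
  that for \<open>T\<close> is \<open>\<mu> / (r ^ k * \<rho>) - 1\<close>. Since
  \<open>r ^ k > 0\<close>, clearing denominators turns both signs into the stated polynomial
  inequalities. The weaker criteria for \<open>T\<close> follow from r^2 \<le> \<open>\<rho>\<close>
  \<le> r^2 + a^2. The component for \<open>Phi\<close> is a nonnegative term plus a positive one,
  and the one for \<open>Theta\<close> is \<open>\<rho>\<close> itself. For the sphere angles it
  remains to see that the round metric is positive on coordinate vectors
  (\<open>round_metric_unit_pos\<close>), that is, that the chart has nonzero partial
  derivatives.\<close>

lemma sphere_diff_zero: "sphere_diff n \<psi> (\<lambda>_. 0) k = 0"
  by (simp add: sphere_diff_def)

lemma round_metric_zero: "round_metric n \<psi> (\<lambda>_. 0) (\<lambda>_. 0) = 0"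
  by (simp add: round_metric_def sphere_diff_zero)

lemma sphere_diff_unit_same:
  assumes "i < n"
  shows "sphere_diff n \<psi> (\<lambda>j. if j = i then 1 else 0) i = - sin (\<psi> i) * (\<Prod>j<i. sin (\<psi> j))"
proof -
  have "sphere_param n (\<lambda>j. \<psi> j + s * (if j = i then 1 else 0)) i
      = cos (\<psi> i + s) * (\<Prod>j<i. sin (\<psi> j))" for s
    using assms by (simp add: sphere_param_def)
  moreover have "((\<lambda>s. cos (\<psi> i + s) * (\<Prod>j<i. sin (\<psi> j))) has_real_derivative
      - sin (\<psi> i) * (\<Prod>j<i. sin (\<psi> j))) (at 0)"
    by (auto intro!: derivative_eq_intros)
  ultimately show ?thesis
    unfolding sphere_diff_def by (simp add: DERIV_imp_deriv)
qed

text \<open>The final Cartesian coordinate carries no cosine factor, so the last angle enters it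
  only through its sine. This supplies a nonzero derivative where the sine of that angle
  vanishes.\<close>

lemma sphere_diff_unit_last:
  "sphere_diff (Suc i) \<psi> (\<lambda>j. if j = i then 1 else 0) (Suc i) = cos (\<psi> i) * (\<Prod>j<i. sin (\<psi> j))"
proof -
  have "sphere_param (Suc i) (\<lambda>j. \<psi> j + s * (if j = i then 1 else 0)) (Suc i)
      = sin (\<psi> i + s) * (\<Prod>j<i. sin (\<psi> j))" for s
    by (simp add: sphere_param_def)
  moreover have "((\<lambda>s. sin (\<psi> i + s) * (\<Prod>j<i. sin (\<psi> j))) has_real_derivative
      cos (\<psi> i) * (\<Prod>j<i. sin (\<psi> j))) (at 0)"
    by (auto intro!: derivative_eq_intros)
  ultimately show ?thesis
    unfolding sphere_diff_def by (simp add: DERIV_imp_deriv)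
qed

text \<open>As a pullback, the round metric gives the squared Euclidean length of the partial
  derivative of the embedding, so one nonzero Cartesian component suffices.\<close>

lemma round_metric_unit_pos:
  assumes nd: "sphere_nondegenerate n \<psi>" and i: "i < n"
  shows "round_metric n \<psi> (\<lambda>j. if j = i then 1 else 0) (\<lambda>j. if j = i then 1 else 0) > 0"
proof -
  define D where "D = sphere_diff n \<psi> (\<lambda>j. if j = i then 1 else 0)"
  \<comment> \<open>Each j < i satisfies \<open>Suc j < n\<close>, so non-degeneracy applies to
    every factor.\<close>
  have prod: "(\<Prod>j<i. sin (\<psi> j)) \<noteq> 0"
    using nd i by (auto simp: sphere_nondegenerate_def)
  have "\<exists>k\<le>n. D k \<noteq> 0"
  proof (cases "sin (\<psi> i) = 0")
    case False
    then have "D i \<noteq> 0"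
      using prod i by (simp add: D_def sphere_diff_unit_same)
    with i show ?thesis by (intro exI[of _ i]) simp
  next
    case True
    \<comment> \<open>Non-degeneracy then forces \<open>i\<close> to be the last angle, which also enters the last Cartesian coordinate.\<close>
    then have n: "n = Suc i"
      using nd i unfolding sphere_nondegenerate_def by (metis Suc_lessI)
    have "cos (\<psi> i) \<noteq> 0"
      using True sin_cos_squared_add[of "\<psi> i"] by auto
    then have "D n \<noteq> 0"
      unfolding D_def n sphere_diff_unit_last using prod by simp
    then show ?thesis by blast
  qed
  then obtain k where "k \<le> n" "D k \<noteq> 0" by blast
  then have "(\<Sum>k\<le>n. D k * D k) > 0"
    by (intro sum_pos2[of _ k]) (auto simp: zero_less_mult_iff linorder_neq_iff)
  then show ?thesis
    by (simp add: round_metric_def D_def)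
qed

lemma g_MP1_R: "g_MP1 d \<mu> a x (coord_vec R) (coord_vec R) = rho2 a x / Delta_MP1 d \<mu> a (x R)"
  by (simp add: g_MP1_def coord_vec_def round_metric_zero)

lemma g_MP1_T:
  "g_MP1 d \<mu> a x (coord_vec T) (coord_vec T) = \<mu> / (x R ^ (d - 4) * rho2 a x) - 1"
  by (simp add: g_MP1_def coord_vec_def round_metric_zero)

lemma g_MP1_Phi:
  "g_MP1 d \<mu> a x (coord_vec Phi) (coord_vec Phi) =
     \<mu> / (x R ^ (d - 4) * rho2 a x) * (a * (sin (x Theta))\<^sup>2)\<^sup>2
     + ((x R)\<^sup>2 + a\<^sup>2) * (sin (x Theta))\<^sup>2"
  by (simp add: g_MP1_def coord_vec_def round_metric_zero power2_eq_square)

lemma g_MP1_Theta: "g_MP1 d \<mu> a x (coord_vec Theta) (coord_vec Theta) = rho2 a x"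
  by (simp add: g_MP1_def coord_vec_def round_metric_zero)

lemma g_MP1_Sph:
  "g_MP1 d \<mu> a x (coord_vec (Sph i)) (coord_vec (Sph i)) =
     (x R)\<^sup>2 * (cos (x Theta))\<^sup>2
     * round_metric (d - 3) (\<lambda>j. x (Sph j)) (\<lambda>j. if j = i then 1 else 0) (\<lambda>j. if j = i then 1 else 0)"
  by (simp add: g_MP1_def coord_vec_def)

theorem mainTheorem6:
  fixes d k :: nat and \<mu> a r \<theta> :: real and x :: point
    and g :: "tangent \<Rightarrow> tangent \<Rightarrow> real"
  assumes "d \<ge> 4" and "\<mu> > 0"
    and "x \<in> MP1_region d \<mu> a"
    and "r = x R" and "\<theta> = x Theta"
    and "k = d - 4"
    and "g = g_MP1 d \<mu> a x"
  shows
    "((d = 4 \<longrightarrow>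
        (r\<^sup>2 > \<mu> - a\<^sup>2 \<longrightarrow> spacelike g (coord_vec R)) \<and>
        (r\<^sup>2 < \<mu> - a\<^sup>2 \<longrightarrow> timelike g (coord_vec R))) \<and>
     (d \<ge> 5 \<longrightarrow>
        (r ^ (2 + k) + a\<^sup>2 * r ^ k > \<mu> \<longrightarrow> spacelike g (coord_vec R)) \<and>
        (r ^ (2 + k) + a\<^sup>2 * r ^ k < \<mu> \<longrightarrow> timelike g (coord_vec R)))) \<and>
     spacelike g (coord_vec Phi) \<and>
     ((d = 4 \<longrightarrow>
        (r\<^sup>2 > \<mu> - a\<^sup>2 * (cos \<theta>)\<^sup>2 \<longrightarrow> timelike g (coord_vec T)) \<and>
        (r\<^sup>2 < \<mu> - a\<^sup>2 * (cos \<theta>)\<^sup>2 \<longrightarrow> spacelike g (coord_vec T)) \<and>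
        (r\<^sup>2 > \<mu> \<longrightarrow> timelike g (coord_vec T)) \<and>
        (r\<^sup>2 < \<mu> - a\<^sup>2 \<longrightarrow> spacelike g (coord_vec T))) \<and>
     (d \<ge> 5 \<longrightarrow>
        (\<mu> > r ^ k * (r\<^sup>2 + a\<^sup>2 * (cos \<theta>)\<^sup>2) \<longrightarrow> spacelike g (coord_vec T)) \<and>
        (\<mu> < r ^ k * (r\<^sup>2 + a\<^sup>2 * (cos \<theta>)\<^sup>2) \<longrightarrow> timelike g (coord_vec T)) \<and>
        (r ^ (2 + k) + a\<^sup>2 * r ^ k < \<mu> \<longrightarrow> spacelike g (coord_vec T)) \<and>
        (r ^ (2 + k) > \<mu> \<longrightarrow> timelike g (coord_vec T)))) \<and>
     spacelike g (coord_vec Theta) \<and> (\<forall>i < d - 3. spacelike g (coord_vec (Sph i)))"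
proof -
  have r0: "r \<noteq> 0" and s0: "sin \<theta> \<noteq> 0" and c0: "cos \<theta> \<noteq> 0"
    and nd: "sphere_nondegenerate (d - 3) (\<lambda>i. x (Sph i))"
    using assms by (auto simp: MP1_region_def)
  \<comment> \<open>For \<open>d = 4\<close> the power is 1, whatever the sign of r; for
    \<open>d \<ge> 5\<close> the region has r > 0.\<close>
  have rk: "r ^ k > 0"
    using assms by (cases "d = 4") (auto simp: MP1_region_def)
  define \<rho> where "\<rho> = r\<^sup>2 + a\<^sup>2 * (cos \<theta>)\<^sup>2"
  have rho: "rho2 a x = \<rho>"
    by (simp add: rho2_def \<rho>_def assms)
  have rho_pos: "\<rho> > 0"
    unfolding \<rho>_def using r0 by (intro add_pos_nonneg) auto
  have "a\<^sup>2 * (cos \<theta>)\<^sup>2 \<le> a\<^sup>2"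
    by (simp add: mult_left_le cos_squared_eq)
  then have "r\<^sup>2 \<le> \<rho>" "\<rho> \<le> r\<^sup>2 + a\<^sup>2"
    unfolding \<rho>_def by auto
  \<comment> \<open>These bounds place the threshold \<open>r ^ k * \<rho>\<close> for
    \<open>T\<close> between the two cruder ones that do not involve the angle.\<close>
  then have le: "r ^ (2 + k) \<le> r ^ k * \<rho>" "r ^ k * \<rho> \<le> r ^ (2 + k) + a\<^sup>2 * r ^ k"
    using mult_left_mono[of "r\<^sup>2" \<rho> "r ^ k"] mult_left_mono[of \<rho> "r\<^sup>2 + a\<^sup>2" "r ^ k"] rk
    by (auto simp: algebra_simps power_add power2_eq_square)
  \<comment> \<open>Over the positive denominator \<open>r ^ k\<close>, the sign is that of the
    numerator.\<close>
  have Delta: "Delta_MP1 d \<mu> a (x R) = (r ^ (2 + k) + a\<^sup>2 * r ^ k - \<mu>) / r ^ k"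
    using rk r0 assms by (simp add: Delta_MP1_def field_simps power_add power2_eq_square)
  have R_space: "spacelike g (coord_vec R)" if "r ^ (2 + k) + a\<^sup>2 * r ^ k > \<mu>"
    using that rk rho_pos by (simp add: spacelike_def assms(7) g_MP1_R rho Delta)
  have R_time: "timelike g (coord_vec R)" if "r ^ (2 + k) + a\<^sup>2 * r ^ k < \<mu>"
    using that rk rho_pos
    by (simp add: timelike_def assms(7) g_MP1_R rho Delta divide_pos_neg mult_pos_neg)
  have gT: "g (coord_vec T) (coord_vec T) = \<mu> / (r ^ k * \<rho>) - 1"
    by (simp add: assms(4,6,7) g_MP1_T flip: rho)
  have T_space: "spacelike g (coord_vec T)" if "\<mu> > r ^ k * \<rho>"
    using that rk rho_pos by (simp add: spacelike_def gT less_divide_eq)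
  have T_time: "timelike g (coord_vec T)" if "\<mu> < r ^ k * \<rho>"
    using that rk rho_pos by (simp add: timelike_def gT divide_less_eq)
  \<comment> \<open>The first summand vanishes when a = 0; strictness comes from the second, as r
    and the sine are nonzero.\<close>
  have "\<mu> / (r ^ k * \<rho>) * (a * (sin \<theta>)\<^sup>2)\<^sup>2 + (r\<^sup>2 + a\<^sup>2) * (sin \<theta>)\<^sup>2 > 0"
    using rk rho_pos r0 s0 \<open>\<mu> > 0\<close>
    by (intro add_nonneg_pos mult_pos_pos mult_nonneg_nonneg add_pos_nonneg) auto
  then have Phi: "spacelike g (coord_vec Phi)"
    by (simp add: spacelike_def assms(4-7) g_MP1_Phi flip: rho)
  have Theta: "spacelike g (coord_vec Theta)"
    by (simp add: spacelike_def assms(7) g_MP1_Theta rho rho_pos)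
  have Sph: "spacelike g (coord_vec (Sph i))" if "i < d - 3" for i
    using round_metric_unit_pos[OF nd that] r0 c0
    by (simp add: spacelike_def assms(4,5,7) g_MP1_Sph)
  \<comment> \<open>With k = 0 the criteria for \<open>d = 4\<close> become instances of the general
    ones.\<close>
  have k0: "k = 0" if "d = 4"
    using that assms(6) by simp
  show ?thesis
    unfolding \<rho>_def[symmetric]
  proof (intro conjI impI allI Phi Theta Sph)
    assume "d = 4"
    note [simp] = k0[OF this]
    show "spacelike g (coord_vec R)" if "r\<^sup>2 > \<mu> - a\<^sup>2"
      using that R_space by simp
    show "timelike g (coord_vec R)" if "r\<^sup>2 < \<mu> - a\<^sup>2"
      using that R_time by simp
    show "timelike g (coord_vec T)" if "r\<^sup>2 > \<mu> - a\<^sup>2 * (cos \<theta>)\<^sup>2"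
      using that T_time by (simp add: \<rho>_def)
    show "spacelike g (coord_vec T)" if "r\<^sup>2 < \<mu> - a\<^sup>2 * (cos \<theta>)\<^sup>2"
      using that T_space by (simp add: \<rho>_def)
    show "timelike g (coord_vec T)" if "r\<^sup>2 > \<mu>"
      using that T_time le by simp
    show "spacelike g (coord_vec T)" if "r\<^sup>2 < \<mu> - a\<^sup>2"
      using that T_space le by simp
  \<comment> \<open>What is left is the case \<open>d \<ge> 5\<close>, where the goals already have
    the form of the general criteria, up to the bounds \<open>le\<close>.\<close>
  qed (use R_space R_time T_space T_time le in auto)
qed

end
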